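(* There exists a generic six-line arrangement $\mathcal{H}^2_6=\{H_i: a_{i1}x_1+a_{i2}x_2=c_i,\ 1\leq i\leq 6\}$ in $\mathbb{R}^2$ such that the set $\{(a_{i1},a_{i2})\mid 1\leq i\leq 6\}$ is very generic (so that the associated discriminantal arrangement $\{M_{\{i_1,i_2,i_3\}}\mid 1\leq i_1<i_2<i_3\leq 6\}$ in $\mathbb{R}^6$ is very generic, i.e. sufficiently general), and such that not every triangular cell of $\mathcal{H}^2_6$ gives rise to a codimension-one boundary of the convex cone $C$ of the discriminantal arrangement containing $(c_1,c_2,c_3,c_4,c_5,c_6)$; that is, there is a triangular cell $\Delta H_iH_jH_k$ of $\mathcal{H}^2_6$ such that $M_{\{i,j,k\}}$ is not a codimension-one boundary hyperplane of $C$.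
   Context: A line arrangement in $\mathbb{R}^2$ is generic if any two of its lines meet in exactly one point and no three of its lines have a common point. A finite set of vectors in $\mathbb{R}^2$ is generic if every subset of cardinality at most $2$ is linearly independent. For an $n\times 2$ matrix $X=[x_{ij}]$ and $S=\{i_1<i_2<i_3\}\subset\{1,\ldots,n\}$, let $L_{S,X}(y_1,\ldots,y_n)$ be the determinant of the $3\times3$ matrix whose $t$-th row is $(x_{i_t1},x_{i_t2},y_{i_t})$, a linear form in $y$. For $A=[a_{ij}]$, the associated discriminantal arrangement consists of the hyperplanes $M_S=\{y\in\mathbb{R}^n\mid L_{S,A}(y)=0\}$ for all $3$-subsets $S$. Let $\mathrm{Disc}(X)$ be the $\binom n3\times n$ matrix whose row indexed by $S$ is the coefficient vector of $L_{S,X}$. For a collection $\mathcal{S}=\{S_1,\ldots,S_l\}$ of distinct $3$-subsets, let $P_{\mathcal{S}}(X)$ be the sum of squares of all $l\times l$ minors of the $l\times n$ submatrix of $\mathrm{Disc}(X)$ with rows $S_1,\ldots,S_l$. A generic set of $n$ vectors with matrix $A$ is very generic (and its discriminantal arrangement is very generic, or sufficiently general) if $P_{\mathcal{S}}(A)\ne0$ for every $\mathcal{S}$ such that $P_{\mathcal{S}}(X)$ is not the zero polynomial in the indeterminates $x_{ij}$. Here $n=6$. A convex cone of the discriminantal arrangement is a region, i.e. a connected component of the complement in $\mathbb{R}^6$ of the union of the hyperplanes $M_S$; since $\mathcal{H}^2_6$ is generic, $(c_1,\ldots,c_6)$ lies in exactly one such region $C$. The hyperplane $M_S$ is a codimension-one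 boundary hyperplane of $C$ if $M_S\cap\overline{C}$ is a face of dimension $5$ of the closure $\overline{C}$. A triangular cell (2-simplex region) $\Delta H_iH_jH_k$ of $\mathcal{H}^2_6$ is a bounded region of the complement of the six lines which is the interior of the triangle formed by $H_i,H_j,H_k$. The cell $\Delta H_iH_jH_k$ gives rise to a codimension-one boundary of $C$ if $M_{\{i,j,k\}}$ is a codimension-one boundary hyperplane of $C$. *)

theory Defs
  imports
    "Jordan_Normal_Form.Determinant"
    "HOL-Library.Poly_Mapping"
    "HOL-Analysis.Analysis"
begin

(* Both vec_index and vec_nth are written with the same infix symbol. *)
no_notation vec_index (infixl "$" 100)

section \<open>Generic line arrangements and triangular cells\<close>

(* The lines are indexed by a finite type; distinctness of the lines follows from the
   second conjunct, since two equal lines share infinitely many points. *)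
definition generic_line_arrangement :: "('n::finite \<Rightarrow> (real^2) set) \<Rightarrow> bool" where
  "generic_line_arrangement H \<longleftrightarrow>
     (\<forall>i. affine (H i) \<and> aff_dim (H i) = 1) \<and>
     (\<forall>i j. i \<noteq> j \<longrightarrow> (\<exists>!p. p \<in> H i \<inter> H j)) \<and>
     (\<forall>i j k. i \<noteq> j \<and> i \<noteq> k \<and> j \<noteq> k \<longrightarrow> H i \<inter> H j \<inter> H k = {})"

definition arr_line :: "real^2^'n \<Rightarrow> real^'n \<Rightarrow> 'n \<Rightarrow> (real^2) set" where
  "arr_line A c i = {x. A $ i $ 1 * x $ 1 + A $ i $ 2 * x $ 2 = c $ i}"

definition triangular_cell ::
    "('n::finite \<Rightarrow> (real^2) set) \<Rightarrow> 'n \<Rightarrow> 'n \<Rightarrow> 'n \<Rightarrow> (real^2) set \<Rightarrow> bool" where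
  "triangular_cell H i j k R \<longleftrightarrow>
     i \<noteq> j \<and> i \<noteq> k \<and> j \<noteq> k \<and>
     R \<in> components (- (\<Union>l. H l)) \<and> bounded R \<and>
     (\<exists>p q r. H j \<inter> H k = {p} \<and> H i \<inter> H k = {q} \<and> H i \<inter> H j = {r} \<and>
              R = interior (convex hull {p, q, r}))"


section \<open>Discriminantal arrangements\<close>

(* Stated over an arbitrary commutative ring, so that it applies both to real matrices and
   to the matrix of indeterminates. For card S = 3 the sorted enumeration of S is
   i_1 < i_2 < i_3; other S are never used. *)
definition disc_form ::
    "'n::{finite,linorder} set \<Rightarrow> 'a::comm_ring_1^2^'n::{finite,linorder} \<Rightarrow>
     'a^'n::{finite,linorder} \<Rightarrow> 'a" where
  "disc_form S X y =
     Determinants.det (vector (map (\<lambda>i. vector [X $ i $ 1, X $ i $ 2, y $ i])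
                                (sorted_list_of_set S)) :: 'a^3^3)"

definition disc_hyperplane ::
    "real^2^'n::{finite,linorder} \<Rightarrow> 'n::{finite,linorder} set \<Rightarrow> (real^'n::{finite,linorder}) set" where
  "disc_hyperplane A S = {y. disc_form S A y = 0}"

definition disc_complement :: "real^2^'n::{finite,linorder} \<Rightarrow> (real^'n::{finite,linorder}) set" where
  "disc_complement A = - (\<Union>S \<in> {S. card S = 3}. disc_hyperplane A S)"

definition codim_one_boundary :: "'a::euclidean_space set \<Rightarrow> 'a set \<Rightarrow> bool" where
  "codim_one_boundary M C \<longleftrightarrow>
     (M \<inter> closure C) face_of (closure C) \<and> aff_dim (M \<inter> closure C) = int DIM('a) - 1"


section \<open>Very generic vectors\<close>

(* The form is linear in y, so its coefficient at y_j is its value at the j-th unit vector. *)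
definition disc_row ::
    "'a::comm_ring_1^2^'n::{finite,linorder} \<Rightarrow> 'n::{finite,linorder} set \<Rightarrow> 'a^'n::{finite,linorder}" where
  "disc_row X S = (\<chi> j. disc_form S X (axis j 1))"

(* The list Ss is S_1, ..., S_l. The sum ranges over the l-subsets T of the columns; the
   minor size l is not fixed by a type, hence the determinant of the carrier-based matrices. *)
definition minor_sum ::
    "'n::{finite,linorder} set list \<Rightarrow> 'a::comm_ring_1^2^'n::{finite,linorder} \<Rightarrow> 'a" where
  "minor_sum Ss X =
     (\<Sum>T \<in> {T. card T = length Ss}.
        (Determinant.det (Matrix.mat (length Ss) (length Ss)
           (\<lambda>(s, t). disc_row X (Ss ! s) $ (sorted_list_of_set T ! t))))\<^sup>2)"

(* Multivariate polynomials: finitely supported maps from monomials to coefficients, a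
   monomial being a finitely supported exponent map on the indeterminates. *)
type_synonym 'v rpoly = "('v \<Rightarrow>\<^sub>0 nat) \<Rightarrow>\<^sub>0 real"

definition indet :: "'v \<Rightarrow> 'v rpoly" where
  "indet v = Poly_Mapping.single (Poly_Mapping.single v 1) 1"

definition generic_matrix :: "(('n \<times> 2) rpoly)^2^'n" where
  "generic_matrix = (\<chi> i j. indet (i, j))"

definition generic_vectors :: "(real^2) set \<Rightarrow> bool" where
  "generic_vectors V \<longleftrightarrow>
     finite V \<and> (\<forall>B \<subseteq> V. card B \<le> 2 \<longrightarrow> independent B)"

(* The cardinality condition says that the rows of A are pairwise distinct, i.e. that A is
   the matrix of a set of n vectors. *)
definition very_generic :: "real^2^'n::{finite,linorder} \<Rightarrow> bool" where
  "very_generic A \<longleftrightarrow>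
     card (Finite_Cartesian_Product.rows A) = CARD('n) \<and>
     generic_vectors (Finite_Cartesian_Product.rows A) \<and>
     (\<forall>Ss. distinct Ss \<and> (\<forall>S \<in> set Ss. card S = 3) \<and>
           minor_sum Ss generic_matrix \<noteq> 0 \<longrightarrow>
           minor_sum Ss A \<noteq> 0)"

end

theory Submission
  imports Defs
begin

(* Both scalar_prod and inner are written with the same infix symbol. *)
no_notation scalar_prod (infix "\<bullet>" 70)

text \<open>
  Write \<open>L\<^bsub>ijk\<^esub>\<close> for the form whose vanishing makes the lines \<open>i\<close>, \<open>j\<close>, \<open>k\<close> concurrent. Let the lines
  \<open>3\<close>, \<open>4\<close>, \<open>5\<close> bound a triangle, and let \<open>0\<close>, \<open>1\<close>, \<open>2\<close> be lines through its three vertices that form a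
  smaller triangle inside it, as in Routh's theorem. While only translations of the lines are
  allowed and the cevians pass through the vertices, the inner triangle is a fixed multiple of the
  outer one in size. Pushing a cevian past its vertex, away from the inner triangle, enlarges the
  inner triangle further. Hence \<open>L\<^bsub>012\<^esub>\<close> is a combination, with coefficients of constant sign, of the
  size \<open>L\<^bsub>345\<^esub>\<close> of the outer triangle and of the three displacements \<open>L\<^bsub>034\<^esub>\<close>, \<open>L\<^bsub>145\<^esub>\<close>, \<open>L\<^bsub>235\<^esub>\<close>; this is
  \<open>triple_form_relation\<close>. On the closure of the region the four terms are nonnegative, so \<open>L\<^bsub>012\<^esub>\<close>
  vanishes there only where all of them do, which is a set of codimension at least two. Yet for
  small displacements the inner triangle is a cell: it lies inside the outer one
  (\<open>routh_triangular_cell\<close>, \<open>routh_not_codim_one_boundary\<close>).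

  All this is stable under small changes of the normal vectors, so it remains to see that very
  generic matrices are dense (\<open>very_generic_dense\<close>). They are the complement of the zero sets of
  finitely many nonzero polynomials. Along a curve \<open>x\<^sub>v = a\<^sub>v + t ^ e\<^sub>v\<close> through an arbitrary point \<open>a\<close> the
  leading term of a monomial has as exponent the weight of that monomial; if the weights \<open>e\<^sub>v\<close>
  separate the monomials, no nonzero polynomial in question can vanish identically on the curve,
  and each has only finitely many zeros there (\<open>poly_at_curve_finite_zeros\<close>).
\<close>

section \<open>Evaluation of multivariate polynomials\<close>

text \<open>
  The ring of values is left open because monomials are also evaluated at univariate polynomials,
  which describe the restriction to a curve.
\<close>
definition monomial_at :: "('v::finite \<Rightarrow> 'a::comm_semiring_1) \<Rightarrow> ('v \<Rightarrow>\<^sub>0 nat) \<Rightarrow> 'a" where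
  "monomial_at x m = (\<Prod>v\<in>UNIV. x v ^ Poly_Mapping.lookup m v)"

definition poly_at :: "('v::finite \<Rightarrow> real) \<Rightarrow> 'v rpoly \<Rightarrow> real" where
  "poly_at x f = (\<Sum>m\<in>Poly_Mapping.keys f. Poly_Mapping.lookup f m * monomial_at x m)"

lemma monomial_at_zero: "monomial_at x 0 = 1"
  by (simp add: monomial_at_def)

lemma monomial_at_add: "monomial_at x (m + m') = monomial_at x m * monomial_at x m'"
  by (simp add: monomial_at_def lookup_add power_add prod.distrib)

lemma poly_at_superset:
  assumes "finite M" "Poly_Mapping.keys f \<subseteq> M"
  shows "poly_at x f = (\<Sum>m\<in>M. Poly_Mapping.lookup f m * monomial_at x m)"
  unfolding poly_at_def using assms
  by (intro sum.mono_neutral_left) (auto simp: in_keys_iff)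

lemma poly_at_single: "poly_at x (Poly_Mapping.single m c) = c * monomial_at x m"
  by (subst poly_at_superset[of "{m}"]) (auto simp: lookup_single)

lemma poly_at_add: "poly_at x (f + g) = poly_at x f + poly_at x g"
proof -
  let ?M = "Poly_Mapping.keys f \<union> Poly_Mapping.keys g"
  have "poly_at x (f + g) = (\<Sum>m\<in>?M. Poly_Mapping.lookup (f + g) m * monomial_at x m)"
    by (intro poly_at_superset) (use Poly_Mapping.keys_add[of f g] in auto)
  also have "\<dots> = (\<Sum>m\<in>?M. Poly_Mapping.lookup f m * monomial_at x m)
      + (\<Sum>m\<in>?M. Poly_Mapping.lookup g m * monomial_at x m)"
    by (simp add: lookup_add distrib_right sum.distrib)
  also have "\<dots> = poly_at x f + poly_at x g"
    by (simp add: poly_at_superset[of ?M])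
  finally show ?thesis .
qed

lemma update_eq_add_single:
  "k \<notin> Poly_Mapping.keys f \<Longrightarrow> Poly_Mapping.update k c f = f + Poly_Mapping.single k c"
  by (rule poly_mapping_eqI) (auto simp: lookup_update lookup_add lookup_single in_keys_iff)

lemma poly_at_mult_single:
  "poly_at x (f * Poly_Mapping.single m c) = poly_at x f * (c * monomial_at x m)"
proof (induction f rule: update_induct)
  case (update f m' c')
  then show ?case
    by (simp add: update_eq_add_single distrib_right poly_at_add mult_single poly_at_single
        monomial_at_add)
qed (simp add: poly_at_def)

lemma poly_at_mult: "poly_at x (f * g) = poly_at x f * poly_at x g"
proof (induction g rule: update_induct)
  case (update g m c)
  then show ?case
    by (simp add: update_eq_add_single distrib_left poly_at_add poly_at_mult_single poly_at_single)
qed (simp add: poly_at_def)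

lemma comm_ring_hom_poly_at: "comm_ring_hom (poly_at x)"
proof
  show "poly_at x 1 = 1"
    using poly_at_single[of x 0 1] by (simp add: monomial_at_zero)
qed (simp_all add: poly_at_add poly_at_mult poly_at_def[of x 0])

lemma poly_at_indet: "poly_at x (indet v) = x v"
  unfolding indet_def poly_at_single monomial_at_def
  by (subst prod.remove[of _ v]) (auto simp: lookup_single)

section \<open>Nonzero polynomials on monomial curves\<close>

lemma base_expansion_inj:
  fixes c d :: "nat \<Rightarrow> nat"
  assumes "(\<Sum>i<n. c i * N ^ i) = (\<Sum>i<n. d i * N ^ i)"
    and "\<And>i. i < n \<Longrightarrow> c i < N" "\<And>i. i < n \<Longrightarrow> d i < N"
    and "k < n"
  shows "c k = d k"
  using assms
proof (induction n arbitrary: c d k)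
  case (Suc n)
  have *: "(\<Sum>i<Suc n. f i * N ^ i) = f 0 + N * (\<Sum>i<n. f (Suc i) * N ^ i)" for f :: "nat \<Rightarrow> nat"
    by (simp add: sum.lessThan_Suc_shift sum_distrib_left mult_ac del: sum.lessThan_Suc)
  have eq: "c 0 + N * (\<Sum>i<n. c (Suc i) * N ^ i) = d 0 + N * (\<Sum>i<n. d (Suc i) * N ^ i)"
    using Suc.prems(1) unfolding * .
  have lt: "c 0 < N" "d 0 < N"
    using Suc.prems by auto
  have 0: "c 0 = d 0"
    using arg_cong[OF eq, of "\<lambda>x. x mod N"] lt by simp
  show ?case
  proof (cases k)
    case (Suc k')
    show ?thesis unfolding Suc
      by (rule Suc.IH) (use eq 0 lt Suc.prems Suc in auto)
  qed (use 0 in simp)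
qed simp

text \<open>
  Weights that are powers of a base exceeding all exponents read off the exponents of a monomial as
  digits of its weight.
\<close>
lemma separating_weights:
  fixes M :: "('v::finite \<Rightarrow>\<^sub>0 nat) set"
  assumes "finite M"
  obtains e :: "'v \<Rightarrow> nat" where "\<And>v. e v > 0"
    and "inj_on (\<lambda>m. \<Sum>v\<in>UNIV. Poly_Mapping.lookup m v * e v) M"
proof -
  obtain idx :: "'v \<Rightarrow> nat" where idx: "bij_betw idx UNIV {..<CARD('v)}"
    using ex_bij_betw_finite_nat[of "UNIV :: 'v set"] by (auto simp: atLeast0LessThan)
  define N where "N = Suc (\<Sum>m\<in>M. \<Sum>v\<in>UNIV. Poly_Mapping.lookup m v)"
  have lt: "Poly_Mapping.lookup m v < N" if "m \<in> M" for m v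
  proof -
    have "Poly_Mapping.lookup m v \<le> (\<Sum>v\<in>UNIV. Poly_Mapping.lookup m v)"
      by (rule member_le_sum) auto
    also have "\<dots> \<le> (\<Sum>m\<in>M. \<Sum>v\<in>UNIV. Poly_Mapping.lookup m v)"
      using that assms by (intro member_le_sum) auto
    finally show ?thesis
      by (simp add: N_def)
  qed
  define vr where "vr = the_inv_into UNIV idx"
  have vr: "vr (idx v) = v" for v
    using idx by (simp add: vr_def the_inv_into_f_f bij_betw_def)
  have *: "(\<Sum>v\<in>UNIV. Poly_Mapping.lookup m v * N ^ idx v) =
      (\<Sum>i<CARD('v). Poly_Mapping.lookup m (vr i) * N ^ i)" for m
    using sum.reindex_bij_betw[OF idx, of "\<lambda>i. Poly_Mapping.lookup m (vr i) * N ^ i"]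
    by (simp add: vr)
  show ?thesis
  proof (rule that)
    show "N ^ idx v > 0" for v
      by (simp add: N_def)
    show "inj_on (\<lambda>m. \<Sum>v\<in>UNIV. Poly_Mapping.lookup m v * N ^ idx v) M"
    proof (rule inj_onI)
      fix m m' assume m: "m \<in> M" "m' \<in> M"
        and eq: "(\<Sum>v\<in>UNIV. Poly_Mapping.lookup m v * N ^ idx v) =
          (\<Sum>v\<in>UNIV. Poly_Mapping.lookup m' v * N ^ idx v)"
      show "m = m'"
      proof (rule poly_mapping_eqI)
        fix v
        have "idx v < CARD('v)"
          using idx by (auto simp: bij_betw_def)
        then have "Poly_Mapping.lookup m (vr (idx v)) = Poly_Mapping.lookup m' (vr (idx v))"
          using base_expansion_inj[OF eq[unfolded *]] lt m by blast
        then show "Poly_Mapping.lookup m v = Poly_Mapping.lookup m' v"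
          by (simp add: vr)
      qed
    qed
  qed
qed

lemma sum_poly_distinct_degrees_nonzero:
  fixes p :: "'i \<Rightarrow> 'a::comm_ring_1 poly"
  assumes "finite M" "M \<noteq> {}" "inj_on (\<lambda>m. Polynomial.degree (p m)) M" "\<And>m. m \<in> M \<Longrightarrow> p m \<noteq> 0"
  shows "(\<Sum>m\<in>M. p m) \<noteq> 0"
proof -
  obtain m where m: "m \<in> M" and max: "\<And>m'. m' \<in> M \<Longrightarrow> Polynomial.degree (p m') \<le> Polynomial.degree (p m)"
    using Max_in[of "(\<lambda>m. Polynomial.degree (p m)) ` M"] Max_ge[of "(\<lambda>m. Polynomial.degree (p m)) ` M"] assms(1,2)
    by fastforce
  have "poly.coeff (\<Sum>m\<in>M. p m) (Polynomial.degree (p m)) =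
      (\<Sum>m'\<in>M. if m' = m then poly.coeff (p m) (Polynomial.degree (p m)) else 0)"
    unfolding coeff_sum
  proof (rule sum.cong)
    fix m' assume "m' \<in> M"
    then show "poly.coeff (p m') (Polynomial.degree (p m)) =
        (if m' = m then poly.coeff (p m) (Polynomial.degree (p m)) else 0)"
      using max[of m'] m assms(3) by (auto simp: inj_on_def order.strict_iff_order intro!: coeff_eq_0)
  qed simp
  also have "\<dots> = poly.coeff (p m) (Polynomial.degree (p m))"
    using m assms(1) by simp
  also have "\<dots> \<noteq> 0"
    using assms(4)[OF m] by simp
  finally show ?thesis
    by auto
qed

text \<open>
  Restricted to the curve, a monomial becomes a monic polynomial in \<open>t\<close> whose degree is its weight.
  Distinct weights exclude cancellation of the leading terms, whatever the base point \<open>a\<close> is.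
\<close>
lemma poly_at_curve_finite_zeros:
  fixes a :: "'v::finite \<Rightarrow> real"
  assumes "f \<noteq> 0" and e: "\<And>v. e v > 0"
    and inj: "inj_on (\<lambda>m. \<Sum>v\<in>UNIV. Poly_Mapping.lookup m v * e v) (Poly_Mapping.keys f)"
  shows "finite {t. poly_at (\<lambda>v. a v + t ^ e v) f = 0}"
proof -
  define q where "q v = [:a v:] + Polynomial.monom 1 (e v)" for v
  define p where "p m = monomial_at q m" for m
  have deg_q: "Polynomial.degree (q v) = e v" for v
    using e[of v] unfolding q_def by (subst degree_add_eq_right) (auto simp: degree_monom_eq)
  have q0: "q v \<noteq> 0" for v
    using deg_q[of v] e[of v] by auto
  have p0: "p m \<noteq> 0" for m
    using q0 by (simp add: p_def monomial_at_def)
  have deg_p: "Polynomial.degree (p m) = (\<Sum>v\<in>UNIV. Poly_Mapping.lookup m v * e v)" for m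
    using q0 by (simp add: p_def monomial_at_def degree_prod_sum_eq degree_power_eq deg_q)
  define g where "g = (\<Sum>m\<in>Poly_Mapping.keys f. Polynomial.smult (Poly_Mapping.lookup f m) (p m))"
  have "g \<noteq> 0"
    unfolding g_def
  proof (rule sum_poly_distinct_degrees_nonzero)
    show "inj_on (\<lambda>m. Polynomial.degree (Polynomial.smult (Poly_Mapping.lookup f m) (p m)))
        (Poly_Mapping.keys f)"
      using inj by (auto simp: inj_on_def in_keys_iff deg_p)
  qed (use assms(1) p0 in \<open>auto simp: in_keys_iff\<close>)
  moreover have "poly g t = poly_at (\<lambda>v. a v + t ^ e v) f" for t
    by (simp add: g_def poly_at_def poly_sum p_def monomial_at_def poly_prod q_def poly_monom)
  ultimately show ?thesis
    using poly_roots_finite[of g] by simp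
qed

section \<open>Minors of the discriminantal matrix as polynomials\<close>

definition bracket :: "'a::comm_ring_1^2^'n \<Rightarrow> 'n \<Rightarrow> 'n \<Rightarrow> 'a" where
  "bracket A i j = A $ i $ 1 * A $ j $ 2 - A $ i $ 2 * A $ j $ 1"

definition triple_form :: "'a::comm_ring_1^2^'n \<Rightarrow> 'a^'n \<Rightarrow> 'n \<Rightarrow> 'n \<Rightarrow> 'n \<Rightarrow> 'a" where
  "triple_form A y i j k = bracket A j k * y $ i - bracket A i k * y $ j + bracket A i j * y $ k"

lemma disc_form_sorted:
  assumes "sorted_list_of_set S = [i, j, k]"
  shows "disc_form S A y = triple_form A y i j k"
  by (simp add: disc_form_def assms det_3 triple_form_def bracket_def algebra_simps)

lemma disc_form_ordered:
  assumes "i < j" "j < k"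
  shows "disc_form {i, j, k} A y = triple_form A y i j k"
proof -
  have "sorted_list_of_set (set [i, j, k]) = [i, j, k]"
    by (rule sorted_list_of_set.idem_if_sorted_distinct) (use assms in auto)
  from disc_form_sorted[OF this, of A y] show ?thesis
    by simp
qed

lemma card_3_ordered:
  fixes S :: "'n::linorder set"
  assumes "card S = 3"
  obtains i j k where "S = {i, j, k}" "i < j" "j < k"
proof -
  have fin: "finite S"
    using assms by (metis card.infinite zero_neq_numeral)
  have "length (sorted_list_of_set S) = 3"
    using assms by simp
  then obtain i j k where "sorted_list_of_set S = [i, j, k]"
    unfolding numeral_3_eq_3 length_Suc_conv length_0_conv by blast
  moreover have "sorted (sorted_list_of_set S)" "distinct (sorted_list_of_set S)"
      "set (sorted_list_of_set S) = S"
    using fin by simp_all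
  ultimately show ?thesis
    using that[of i j k] by auto
qed

definition map_entries :: "('a \<Rightarrow> 'b) \<Rightarrow> 'a^'m^'n \<Rightarrow> 'b^'m^'n" where
  "map_entries h X = (\<chi> i j. h (X $ i $ j))"


context comm_ring_hom
begin

lemma hom_bracket: "hom (bracket X i j) = bracket (map_entries hom X) i j"
  by (simp add: bracket_def map_entries_def hom_minus hom_mult)

lemma hom_disc_row:
  assumes "card S = 3"
  shows "hom (disc_row X S $ l) = disc_row (map_entries hom X) S $ l"
proof -
  obtain i j k where S: "S = {i, j, k}" "i < j" "j < k"
    using assms by (rule card_3_ordered)
  show ?thesis
    unfolding S(1) disc_row_def using S(2,3)
    by (simp add: disc_form_ordered triple_form_def hom_bracket axis_def hom_minus hom_mult hom_add if_distrib[of hom])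
qed

lemma hom_minor_sum:
  assumes "\<forall>S\<in>set Ss. card S = 3"
  shows "hom (minor_sum Ss X) = minor_sum Ss (map_entries hom X)"
proof -
  have mat: "map_mat hom (Matrix.mat (length Ss) (length Ss)
        (\<lambda>(s, t). disc_row X (Ss ! s) $ (sorted_list_of_set T ! t))) =
      Matrix.mat (length Ss) (length Ss)
        (\<lambda>(s, t). disc_row (map_entries hom X) (Ss ! s) $ (sorted_list_of_set T ! t))" for T
    using assms by (intro eq_matI) (auto simp: hom_disc_row)
  show ?thesis
    unfolding minor_sum_def by (simp add: hom_sum hom_power hom_det[symmetric] mat del: hom_det)
qed

end

definition matrix_poly_at :: "real^2^'n \<Rightarrow> ('n::finite \<times> 2) rpoly \<Rightarrow> real" where
  "matrix_poly_at A = poly_at (\<lambda>(i, j). A $ i $ j)"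

lemma map_entries_generic_matrix: "map_entries (matrix_poly_at A) generic_matrix = A"
  by (simp add: map_entries_def generic_matrix_def matrix_poly_at_def poly_at_indet vec_eq_iff)

lemma comm_ring_hom_matrix_poly_at: "comm_ring_hom (matrix_poly_at A)"
  unfolding matrix_poly_at_def by (rule comm_ring_hom_poly_at)

lemma matrix_poly_at_bracket: "matrix_poly_at A (bracket generic_matrix i j) = bracket A i j"
  using comm_ring_hom.hom_bracket[OF comm_ring_hom_matrix_poly_at, of A generic_matrix i j]
  by (simp add: map_entries_generic_matrix)

lemma matrix_poly_at_minor_sum:
  assumes "\<forall>S\<in>set Ss. card S = 3"
  shows "matrix_poly_at A (minor_sum Ss generic_matrix) = minor_sum Ss A"
  using comm_ring_hom.hom_minor_sum[OF comm_ring_hom_matrix_poly_at assms, of A generic_matrix]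
  by (simp add: map_entries_generic_matrix)

section \<open>Density of very generic matrices\<close>

text \<open>
  One curve through a point of the open set serves all polynomials of the family: it stays in the
  set for infinitely many parameters, of which only finitely many are zeros.
\<close>
lemma common_nonzero_dense:
  fixes F :: "('n::finite \<times> 2) rpoly set" and U :: "(real^2^'n) set"
  assumes "finite F" "0 \<notin> F" "open U" "U \<noteq> {}"
  shows "\<exists>A\<in>U. \<forall>f\<in>F. matrix_poly_at A f \<noteq> 0"
proof -
  obtain A0 where A0: "A0 \<in> U"
    using assms by auto
  have "finite (\<Union>f\<in>F. Poly_Mapping.keys f)"
    using assms(1) by simp
  then obtain e :: "'n \<times> 2 \<Rightarrow> nat" where e: "\<And>v. e v > 0"
    and inj: "inj_on (\<lambda>m. \<Sum>v\<in>UNIV. Poly_Mapping.lookup m v * e v) (\<Union>f\<in>F. Poly_Mapping.keys f)"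
    by (rule separating_weights) blast
  define A where "A t = (\<chi> i j. A0 $ i $ j + t ^ e (i, j))" for t :: real
  define Z where "Z f = {t. matrix_poly_at (A t) f = 0}" for f
  have "finite (Z f)" if "f \<in> F" for f
  proof -
    have "inj_on (\<lambda>m. \<Sum>v\<in>UNIV. Poly_Mapping.lookup m v * e v) (Poly_Mapping.keys f)"
      using inj that by (blast intro: inj_on_subset)
    moreover have "f \<noteq> 0"
      using that assms(2) by auto
    ultimately have "finite {t. poly_at (\<lambda>v. (case v of (i, j) \<Rightarrow> A0 $ i $ j) + t ^ e v) f = 0}"
      using e by (intro poly_at_curve_finite_zeros) auto
    then show ?thesis
      by (simp add: Z_def A_def matrix_poly_at_def split_def)
  qed
  then have fin: "finite (\<Union>f\<in>F. Z f)"
    using assms(1) by simp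
  have "continuous_on UNIV A"
    unfolding A_def by (intro continuous_intros)
  then have "open (A -` U)"
    using assms(3) by (simp add: open_vimage)
  moreover have "0 \<in> A -` U"
    using A0 e by (simp add: A_def zero_power)
  ultimately have "infinite (A -` U)"
    using finite_imp_not_open by blast
  then obtain t where "t \<in> A -` U" "t \<notin> (\<Union>f\<in>F. Z f)"
    using fin by (meson finite_subset subsetI)
  then show ?thesis
    by (intro bexI[of _ "A t"]) (auto simp: Z_def)
qed

lemma independent_pair_bracket:
  fixes A :: "real^2^'n"
  assumes "bracket A i j \<noteq> 0"
  shows "A $ i \<noteq> A $ j" "independent {A $ i, A $ j}"
proof -
  have indep: "A $ i \<notin> span {A $ j}" "A $ j \<noteq> 0"
    using assms by (auto simp: span_singleton bracket_def)
  then show "A $ i \<noteq> A $ j"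
    using span_base by force
  show "independent {A $ i, A $ j}"
    using indep by (simp add: independent_insertI)
qed

lemma generic_vectors_rows:
  fixes A :: "real^2^'n::finite"
  assumes br: "\<And>i j. i \<noteq> j \<Longrightarrow> bracket A i j \<noteq> 0" and "CARD('n) \<noteq> 1"
  shows "card (rows A) = CARD('n)" "generic_vectors (rows A)"
proof -
  have rows: "rows A = range (($) A)"
    by (auto simp: rows_def row_def)
  have "inj (($) A)"
    using br independent_pair_bracket(1) by (metis injI)
  then show "card (rows A) = CARD('n)"
    by (simp add: rows card_image)
  show "generic_vectors (rows A)"
    unfolding generic_vectors_def
  proof (intro conjI allI impI)
    show "finite (rows A)"
      by (simp add: rows)
    fix B assume B: "B \<subseteq> rows A" "card B \<le> 2"
    have "\<exists>i j. i \<noteq> j \<and> B \<subseteq> {A $ i, A $ j}"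
    proof -
      have other: "\<exists>j. j \<noteq> i" for i :: 'n
        using \<open>CARD('n) \<noteq> 1\<close> card_1_singleton_iff[of "UNIV :: 'n set"] by auto
      have "card B = 0 \<or> card B = 1 \<or> card B = 2"
        using B(2) by linarith
      moreover have "finite B"
        using B(1) by (rule finite_subset) (simp add: rows)
      moreover have ?thesis if "B = {}"
        using that other[of undefined] by auto
      moreover have ?thesis if "card B = 1"
        using that B(1) other unfolding rows by (force simp: card_1_singleton_iff)
      moreover have ?thesis if "card B = 2"
        using that B(1) unfolding rows by (force simp: card_2_iff)
      ultimately show ?thesis
        by auto
    qed
    then obtain i j where "i \<noteq> j" "B \<subseteq> {A $ i, A $ j}"
      by blast
    then show "independent B"
      using independent_pair_bracket(2)[OF br] independent_mono by blast
  qed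
qed

text \<open>
  The brackets join the nonvanishing conditions because a minor sum can be nonzero when some
  brackets vanish, so that it does not control genericity of the vectors. For a single vector there
  are no brackets, hence the restriction on the number of vectors.
\<close>
lemma very_generic_dense:
  fixes U :: "(real^2^'n::{finite,linorder}) set"
  assumes "open U" "U \<noteq> {}" "CARD('n) \<noteq> 1"
  shows "\<exists>A\<in>U. very_generic A \<and> (\<forall>i j. i \<noteq> j \<longrightarrow> bracket A i j \<noteq> 0)"
proof -
  define L :: "'n set list set" where "L = {Ss. distinct Ss \<and> (\<forall>S\<in>set Ss. card S = 3)}"
  define F :: "('n \<times> 2) rpoly set" where
    "F = (\<lambda>(i, j). bracket generic_matrix i j) ` {(i, j). i \<noteq> j}
       \<union> ((\<lambda>Ss. minor_sum Ss generic_matrix) ` L - {0})"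
  have "finite L"
    unfolding L_def by (rule finite_subset[OF _ finite_subset_distinct[of UNIV]]) auto
  then have "finite F"
    by (simp add: F_def)
  have nz: "bracket generic_matrix i j \<noteq> (0 :: ('n \<times> 2) rpoly)" if "i \<noteq> j" for i j :: 'n
  proof
    define A :: "real^2^'n::{finite,linorder}" where "A = (\<chi> k. if k = i then axis 1 1 else axis 2 1)"
    assume "bracket generic_matrix i j = (0 :: ('n \<times> 2) rpoly)"
    then have "bracket A i j = 0"
      using matrix_poly_at_bracket[of A i j] by (simp add: matrix_poly_at_def poly_at_def)
    then show False
      using that by (simp add: bracket_def A_def axis_def)
  qed
  then have "0 \<notin> F"
    by (auto simp: F_def)
  from common_nonzero_dense[OF \<open>finite F\<close> this assms(1,2)]
  obtain A where "A \<in> U" and A: "\<And>f. f \<in> F \<Longrightarrow> matrix_poly_at A f \<noteq> 0"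
    by blast
  have br: "bracket A i j \<noteq> 0" if "i \<noteq> j" for i j
    using A[of "bracket generic_matrix i j"] that
    by (force simp: F_def matrix_poly_at_bracket)
  have "minor_sum Ss A \<noteq> 0" if "Ss \<in> L" "minor_sum Ss generic_matrix \<noteq> (0 :: ('n \<times> 2) rpoly)" for Ss
    using A[of "minor_sum Ss generic_matrix"] that matrix_poly_at_minor_sum[of Ss A]
    by (auto simp: F_def L_def)
  then have "very_generic A"
    using generic_vectors_rows[OF br assms(3)] by (auto simp: very_generic_def L_def)
  then show ?thesis
    using \<open>A \<in> U\<close> br by blast
qed

section \<open>Triangular cells\<close>

lemma connected_same_sign:
  fixes f :: "'a::topological_space \<Rightarrow> real"
  assumes "connected E" "continuous_on E f" "\<And>x. x \<in> E \<Longrightarrow> f x \<noteq> 0" "x \<in> E" "y \<in> E" "f x > 0"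
  shows "f y > 0"
proof (rule ccontr)
  assume "\<not> f y > 0"
  have "connected (f ` E)"
    using assms by (intro connected_continuous_image)
  then have "0 \<in> f ` E"
    unfolding connected_iff_interval using assms \<open>\<not> f y > 0\<close> 
    by (meson image_eqI less_imp_le not_less)
  then show False
    using assms(3) by auto
qed

text \<open>
  The barycentric coordinates of a point are its normalised distances from the three sides.
\<close>
lemma triangle_halfplanes:
  fixes \<alpha> \<beta> \<gamma> :: "real^2" and p q r :: "real^2"
  assumes p: "\<beta> \<bullet> p = b" "\<gamma> \<bullet> p = c" "\<alpha> \<bullet> p > a"
    and q: "\<alpha> \<bullet> q = a" "\<gamma> \<bullet> q = c" "\<beta> \<bullet> q > b"
    and r: "\<alpha> \<bullet> r = a" "\<beta> \<bullet> r = b" "\<gamma> \<bullet> r > c"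
  shows "convex hull {p, q, r} = {x. \<alpha> \<bullet> x \<ge> a} \<inter> {x. \<beta> \<bullet> x \<ge> b} \<inter> {x. \<gamma> \<bullet> x \<ge> c}" (is "?T = ?I")
proof
  have "convex ?I"
    by (intro convex_Int convex_halfspace_ge)
  moreover have "{p, q, r} \<subseteq> ?I"
    using assms by auto
  ultimately show "?T \<subseteq> ?I"
    by (rule hull_minimal[rotated])
next
  show "?I \<subseteq> ?T"
  proof
    fix x assume x: "x \<in> ?I"
    \<comment> \<open>Barycentric coordinates \<open>(1 - s - t, s, t)\<close> by Cramer's rule.\<close>
    define D where "D = (q $ 1 - p $ 1) * (r $ 2 - p $ 2) - (q $ 2 - p $ 2) * (r $ 1 - p $ 1)"
    have "D \<noteq> 0"
    proof
      assume D: "D = 0"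
      have b: "b = \<beta> $ 1 * p $ 1 + \<beta> $ 2 * p $ 2"
        and \<beta>q: "\<beta> \<bullet> q = \<beta> $ 1 * q $ 1 + \<beta> $ 2 * q $ 2"
        and "\<beta> $ 1 * r $ 1 + \<beta> $ 2 * r $ 2 = b"
        using p(1) r(2) by (simp_all add: inner_vec_def sum_2)
      then have pr: "\<beta> $ 1 * (r $ 1 - p $ 1) + \<beta> $ 2 * (r $ 2 - p $ 2) = 0"
        by (simp add: algebra_simps)
      have "(r $ 2 - p $ 2) * (\<beta> \<bullet> q - b) =
            \<beta> $ 1 * D + (q $ 2 - p $ 2) * (\<beta> $ 1 * (r $ 1 - p $ 1) + \<beta> $ 2 * (r $ 2 - p $ 2))"
          "(r $ 1 - p $ 1) * (\<beta> \<bullet> q - b) =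
            - \<beta> $ 2 * D + (q $ 1 - p $ 1) * (\<beta> $ 1 * (r $ 1 - p $ 1) + \<beta> $ 2 * (r $ 2 - p $ 2))"
        unfolding D_def b \<beta>q by (simp_all add: algebra_simps)
      then have "r = p"
        using D q(3) unfolding pr by (simp add: vec_eq_iff forall_2)
      then show False
        using p(2) r(3) by simp
    qed
    define s where "s = ((x $ 1 - p $ 1) * (r $ 2 - p $ 2) - (x $ 2 - p $ 2) * (r $ 1 - p $ 1)) / D"
    define t where "t = ((q $ 1 - p $ 1) * (x $ 2 - p $ 2) - (q $ 2 - p $ 2) * (x $ 1 - p $ 1)) / D"
    have st: "s * D = (x $ 1 - p $ 1) * (r $ 2 - p $ 2) - (x $ 2 - p $ 2) * (r $ 1 - p $ 1)"
      "t * D = (q $ 1 - p $ 1) * (x $ 2 - p $ 2) - (q $ 2 - p $ 2) * (x $ 1 - p $ 1)"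
      using \<open>D \<noteq> 0\<close> by (simp_all add: s_def t_def)
    have "D * ((1 - s - t) * p $ i + s * q $ i + t * r $ i) =
        D * p $ i + (s * D) * (q $ i - p $ i) + (t * D) * (r $ i - p $ i)" for i
      by (simp add: algebra_simps)
    moreover have "D * p $ 1 + (s * D) * (q $ 1 - p $ 1) + (t * D) * (r $ 1 - p $ 1) = D * x $ 1"
      "D * p $ 2 + (s * D) * (q $ 2 - p $ 2) + (t * D) * (r $ 2 - p $ 2) = D * x $ 2"
      unfolding st by (simp_all add: D_def algebra_simps)
    ultimately have "D * ((1 - s - t) * p $ i + s * q $ i + t * r $ i) = D * x $ i" for i
      using exhaust_2[of i] by metis
    then have x_eq: "x = (1 - s - t) *\<^sub>R p + s *\<^sub>R q + t *\<^sub>R r"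
      using \<open>D \<noteq> 0\<close> by (simp add: vec_eq_iff forall_2)
    have "\<beta> \<bullet> x - b = s * (\<beta> \<bullet> q - b)" "\<gamma> \<bullet> x - c = t * (\<gamma> \<bullet> r - c)"
      "\<alpha> \<bullet> x - a = (1 - s - t) * (\<alpha> \<bullet> p - a)"
      unfolding x_eq inner_add_right inner_scaleR_right p(1,2) q(1,2) r(1,2)
      by (simp_all add: algebra_simps)
    then have "0 \<le> s * (\<beta> \<bullet> q - b)" "0 \<le> t * (\<gamma> \<bullet> r - c)" "0 \<le> (1 - s - t) * (\<alpha> \<bullet> p - a)"
      using x by auto
    then have "s \<ge> 0" "t \<ge> 0" "1 - s - t \<ge> 0"
      using p(3) q(3) r(3) by (auto simp: zero_le_mult_iff)
    then show "x \<in> ?T"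
      unfolding convex_hull_3 mem_Collect_eq using x_eq
      by (intro exI[of _ "1 - s - t"] exI[of _ s] exI[of _ t]) simp
  qed
qed

text \<open>
  A connected set that meets the open triangle and avoids its three side lines cannot leave it.
\<close>
lemma component_of_arrangement_complement:
  fixes H :: "'n \<Rightarrow> (real^2) set"
  assumes H: "H i = {x. \<alpha> \<bullet> x = a}" "H j = {x. \<beta> \<bullet> x = b}" "H k = {x. \<gamma> \<bullet> x = c}"
    and I_def: "I = {x. \<alpha> \<bullet> x > a} \<inter> {x. \<beta> \<bullet> x > b} \<inter> {x. \<gamma> \<bullet> x > c}"
    and "I \<noteq> {}" and disj: "\<And>l. H l \<inter> I = {}"
  shows "I \<in> components (- (\<Union>l. H l))"
proof -
  have "convex I"
    unfolding I_def by (intro convex_Int convex_halfspace_gt)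
  have "I \<subseteq> - (\<Union>l. H l)"
    using disj by blast
  moreover have "E \<subseteq> I" if E: "connected E" "E \<subseteq> - (\<Union>l. H l)" "I \<subseteq> E" for E
  proof
    fix y assume y: "y \<in> E"
    obtain x where x: "x \<in> I"
      using assms by auto
    have same: "\<delta> \<bullet> y - d > 0" if "\<delta> \<bullet> x > d" "H l = {x. \<delta> \<bullet> x = d}" for \<delta> d l
    proof (rule connected_same_sign[OF E(1)])
      show "continuous_on E (\<lambda>x. \<delta> \<bullet> x - d)"
        by (intro continuous_intros)
      show "\<delta> \<bullet> x - d \<noteq> 0" if "x \<in> E" for x
        using that E(2) \<open>H l = _\<close> by auto
    qed (use x y E(3) that in auto)
    show "y \<in> I"
      using same[OF _ H(1)] same[OF _ H(2)] same[OF _ H(3)] x by (auto simp: I_def)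
  qed
  ultimately show ?thesis
    unfolding in_components_maximal using \<open>I \<noteq> {}\<close> convex_connected[OF \<open>convex I\<close>]
    by (metis subset_antisym)
qed

lemma orient_line:
  fixes \<alpha> :: "real^2"
  assumes "\<alpha> \<bullet> p \<noteq> a"
  obtains \<alpha>' a' where "\<alpha>' \<bullet> p > a'" "{x. \<alpha>' \<bullet> x = a'} = {x. \<alpha> \<bullet> x = a}" "\<alpha>' \<noteq> 0 \<longleftrightarrow> \<alpha> \<noteq> 0"
proof (cases "\<alpha> \<bullet> p > a")
  case True
  then show ?thesis
    using that by blast
next
  case False
  show ?thesis
    by (rule that[of "- a" "- \<alpha>"]) (use False assms in auto)
qed

lemma arr_line_inner: "arr_line A c i = {x. A $ i \<bullet> x = c $ i}"
  by (auto simp: arr_line_def inner_vec_def sum_2)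

lemma triangular_cellI:
  fixes A :: "real^2^'n::finite"
  assumes dist: "i \<noteq> j" "i \<noteq> k" "j \<noteq> k" and nz: "\<And>l. A $ l \<noteq> 0"
    and vertices: "arr_line A c j \<inter> arr_line A c k = {p}" "arr_line A c i \<inter> arr_line A c k = {q}"
      "arr_line A c i \<inter> arr_line A c j = {r}"
    and p: "p \<notin> arr_line A c i"
    and miss: "\<And>l. l \<notin> {i, j, k} \<Longrightarrow> arr_line A c l \<inter> convex hull {p, q, r} = {}"
  shows "triangular_cell (arr_line A c) i j k (interior (convex hull {p, q, r}))"
proof -
  let ?H = "arr_line A c"
  note H = arr_line_inner[of A c]
  have on: "p \<in> ?H j" "p \<in> ?H k" "q \<in> ?H i" "q \<in> ?H k" "r \<in> ?H i" "r \<in> ?H j"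
    using vertices by auto
  have "q \<notin> ?H j" "r \<notin> ?H k"
    using vertices p on by (metis IntI singletonD)+
  then have "A $ i \<bullet> p \<noteq> c $ i" "A $ j \<bullet> q \<noteq> c $ j" "A $ k \<bullet> r \<noteq> c $ k"
    using p by (simp_all add: H)
  note off = this
  obtain \<alpha> a where \<alpha>: "\<alpha> \<bullet> p > a" "{x. \<alpha> \<bullet> x = a} = ?H i" "\<alpha> \<noteq> 0"
    unfolding H by (rule orient_line[OF off(1)]) (use nz in simp)
  obtain \<beta> b where \<beta>: "\<beta> \<bullet> q > b" "{x. \<beta> \<bullet> x = b} = ?H j" "\<beta> \<noteq> 0"
    unfolding H by (rule orient_line[OF off(2)]) (use nz in simp)
  obtain \<gamma> d where \<gamma>: "\<gamma> \<bullet> r > d" "{x. \<gamma> \<bullet> x = d} = ?H k" "\<gamma> \<noteq> 0"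
    unfolding H by (rule orient_line[OF off(3)]) (use nz in simp)
  let ?T = "convex hull {p, q, r}"
  have eqs: "\<beta> \<bullet> p = b" "\<gamma> \<bullet> p = d" "\<alpha> \<bullet> q = a" "\<gamma> \<bullet> q = d" "\<alpha> \<bullet> r = a" "\<beta> \<bullet> r = b"
    using on unfolding \<alpha>(2)[symmetric] \<beta>(2)[symmetric] \<gamma>(2)[symmetric] by simp_all
  then have T: "?T = {x. \<alpha> \<bullet> x \<ge> a} \<inter> {x. \<beta> \<bullet> x \<ge> b} \<inter> {x. \<gamma> \<bullet> x \<ge> d}"
    using \<alpha>(1) \<beta>(1) \<gamma>(1) by (intro triangle_halfplanes) simp_all
  have int: "interior ?T = {x. \<alpha> \<bullet> x > a} \<inter> {x. \<beta> \<bullet> x > b} \<inter> {x. \<gamma> \<bullet> x > d}"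
    unfolding T interior_Int using \<alpha>(3) \<beta>(3) \<gamma>(3) by (simp add: interior_halfspace_ge)
  have "interior ?T \<in> components (- (\<Union>l. ?H l))"
  proof (rule component_of_arrangement_complement[where H = ?H, OF \<alpha>(2)[symmetric] \<beta>(2)[symmetric] \<gamma>(2)[symmetric] int])
    define m where "m = (1/3) *\<^sub>R (p + q + r)"
    have "\<alpha> \<bullet> m > a" "\<beta> \<bullet> m > b" "\<gamma> \<bullet> m > d"
      using \<alpha>(1) \<beta>(1) \<gamma>(1) by (simp_all add: m_def inner_add_right eqs)
    then show "interior ?T \<noteq> {}"
      unfolding int by blast
    show "?H l \<inter> interior ?T = {}" for l
    proof (cases "l \<in> {i, j, k}")
      case True
      then show ?thesis
        unfolding int using \<alpha>(2) \<beta>(2) \<gamma>(2) by auto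
    next
      case False
      then show ?thesis
        using miss[of l] interior_subset by blast
    qed
  qed
  moreover have "bounded (interior ?T)"
    by (rule bounded_subset[OF bounded_convex_hull interior_subset]) simp
  ultimately show ?thesis
    unfolding triangular_cell_def using dist vertices by blast
qed

section \<open>Line arrangements and the forms of triples\<close>

lemma arr_line_Int_nonparallel:
  assumes "bracket A i j \<noteq> 0"
  shows "\<exists>p. arr_line A c i \<inter> arr_line A c j = {p}"
proof
  let ?p = "vector [(c $ i * A $ j $ 2 - c $ j * A $ i $ 2) / bracket A i j,
                    (A $ i $ 1 * c $ j - A $ j $ 1 * c $ i) / bracket A i j] :: real^2"
  show "arr_line A c i \<inter> arr_line A c j = {?p}"
  proof (intro equalityI subsetI)
    fix x assume "x \<in> arr_line A c i \<inter> arr_line A c j"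
    then have c: "c $ i = A $ i $ 1 * x $ 1 + A $ i $ 2 * x $ 2" "c $ j = A $ j $ 1 * x $ 1 + A $ j $ 2 * x $ 2"
      by (auto simp: arr_line_def)
    have "x $ 1 * bracket A i j = c $ i * A $ j $ 2 - c $ j * A $ i $ 2"
      "x $ 2 * bracket A i j = A $ i $ 1 * c $ j - A $ j $ 1 * c $ i"
      unfolding bracket_def c by (simp_all add: algebra_simps)
    then have "x = ?p"
      using assms by (simp add: vec_eq_iff forall_2 eq_divide_eq)
    then show "x \<in> {?p}"
      by simp
  next
    fix x assume "x \<in> {?p}"
    then have "x = ?p"
      by simp
    then have x: "x $ 1 * bracket A i j = c $ i * A $ j $ 2 - c $ j * A $ i $ 2"
      "x $ 2 * bracket A i j = A $ i $ 1 * c $ j - A $ j $ 1 * c $ i"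
      using assms by simp_all
    have "(A $ l $ 1 * x $ 1 + A $ l $ 2 * x $ 2) * bracket A i j =
        A $ l $ 1 * (x $ 1 * bracket A i j) + A $ l $ 2 * (x $ 2 * bracket A i j)" for l
      by (simp add: algebra_simps)
    note * = this[unfolded x]
    have "(A $ i $ 1 * x $ 1 + A $ i $ 2 * x $ 2) * bracket A i j = c $ i * bracket A i j"
      "(A $ j $ 1 * x $ 1 + A $ j $ 2 * x $ 2) * bracket A i j = c $ j * bracket A i j"
      unfolding * by (simp_all add: bracket_def algebra_simps)
    then show "x \<in> arr_line A c i \<inter> arr_line A c j"
      using assms by (simp add: arr_line_def)
  qed
qed

text \<open>
  Translating the vertex to the origin kills two of the three terms; this turns signs of the forms
  into positions of a vertex relative to a third line.
\<close>
lemma triple_form_vertex: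
  assumes "p \<in> arr_line A c i" "p \<in> arr_line A c j"
  shows "triple_form A c i j l = bracket A i j * (c $ l - A $ l \<bullet> p)"
proof -
  have c: "c $ i = A $ i $ 1 * p $ 1 + A $ i $ 2 * p $ 2" "c $ j = A $ j $ 1 * p $ 1 + A $ j $ 2 * p $ 2"
    using assms by (auto simp: arr_line_def)
  show ?thesis
    unfolding triple_form_def c by (simp add: bracket_def inner_vec_def sum_2 algebra_simps)
qed

lemma generic_line_arrangement_arr_line:
  fixes A :: "real^2^'n::{finite,linorder}"
  assumes br: "\<And>i j. i \<noteq> j \<Longrightarrow> bracket A i j \<noteq> 0" and nz: "\<And>i. A $ i \<noteq> 0"
    and c: "c \<in> disc_complement A"
  shows "generic_line_arrangement (arr_line A c)"
  unfolding generic_line_arrangement_def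
proof (intro conjI allI impI)
  fix i
  show "affine (arr_line A c i)" "aff_dim (arr_line A c i) = 1"
    unfolding arr_line_inner using nz[of i] by (simp_all add: affine_hyperplane aff_dim_hyperplane)
next
  fix i j :: 'n assume "i \<noteq> j"
  then obtain p where "arr_line A c i \<inter> arr_line A c j = {p}"
    using arr_line_Int_nonparallel br by blast
  then show "\<exists>!p. p \<in> arr_line A c i \<inter> arr_line A c j"
    by simp
next
  fix i j k :: 'n assume dist: "i \<noteq> j \<and> i \<noteq> k \<and> j \<noteq> k"
  show "arr_line A c i \<inter> arr_line A c j \<inter> arr_line A c k = {}"
  proof (rule ccontr)
    assume "arr_line A c i \<inter> arr_line A c j \<inter> arr_line A c k \<noteq> {}"
    then obtain x where x: "\<And>l. l \<in> {i, j, k} \<Longrightarrow> x \<in> arr_line A c l"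
      by auto
    have card: "card {i, j, k} = 3"
      using dist by simp
    then obtain i' j' k' where S: "{i, j, k} = {i', j', k'}" "i' < j'" "j' < k'"
      by (rule card_3_ordered)
    then have "x \<in> arr_line A c l" if "l \<in> {i', j', k'}" for l
      using that x by blast
    then have "triple_form A c i' j' k' = 0"
      using triple_form_vertex[of x A c i' j' k'] by (simp add: arr_line_inner)
    then have "c \<in> disc_hyperplane A {i, j, k}"
      unfolding S(1) using S(2,3) by (simp add: disc_hyperplane_def disc_form_ordered)
    then show False
      using c card by (auto simp: disc_complement_def)
  qed
qed

section \<open>Faces of a region of the discriminantal arrangement\<close>

lemma disc_form_eq_inner:
  fixes A :: "real^2^'n::{finite,linorder}"
  assumes "card S = 3"
  shows "disc_form S A y = disc_row A S \<bullet> y"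
proof -
  obtain i j k where S: "S = {i, j, k}" "i < j" "j < k"
    using assms by (rule card_3_ordered)
  have "linear (disc_form S A)"
    unfolding S(1) using S(2,3)
    by (intro linearI) (simp_all add: disc_form_ordered triple_form_def algebra_simps)
  then have "disc_form S A (\<Sum>j\<in>UNIV. y $ j *\<^sub>R axis j 1) = (\<Sum>j\<in>UNIV. y $ j * disc_form S A (axis j 1))"
    by (simp add: linear_sum linear_scale)
  moreover have "(\<Sum>j\<in>UNIV. y $ j *\<^sub>R axis j 1) = y"
    using basis_expansion[of y] by (simp add: scalar_mult_eq_scaleR)
  ultimately show ?thesis
    by (simp add: inner_vec_def disc_row_def mult.commute)
qed

lemma disc_form_sign_on_closure:
  fixes A :: "real^2^'n::{finite,linorder}"
  assumes C: "C \<in> components (disc_complement A)" and "c \<in> C" "z \<in> closure C" and S: "card S = 3"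
  shows "0 \<le> disc_form S A c * disc_form S A z"
proof -
  have ne: "disc_form S A y \<noteq> 0" if "y \<in> C" for y
    using in_components_subset[OF C] that S by (auto simp: disc_complement_def disc_hyperplane_def)
  have cont: "continuous_on T (\<lambda>y. disc_form S A c * disc_form S A y)" for T
    unfolding disc_form_eq_inner[OF S] by (intro continuous_intros)
  have "0 < disc_form S A c * disc_form S A y" if "y \<in> C" for y
  proof (rule connected_same_sign[OF in_components_connected[OF C] cont _ \<open>c \<in> C\<close> that])
    show "0 < disc_form S A c * disc_form S A c"
      using ne[OF \<open>c \<in> C\<close>] by (metis not_real_square_gt_zero)
  qed (use ne \<open>c \<in> C\<close> in auto)
  then have "C \<subseteq> {y. 0 \<le> disc_form S A c * disc_form S A y}"
    by (auto simp: less_imp_le)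
  moreover have "closed {y. 0 \<le> disc_form S A c * disc_form S A y}"
    by (intro closed_Collect_le cont continuous_intros)
  ultimately show ?thesis
    using closure_minimal \<open>z \<in> closure C\<close> by blast
qed

lemma aff_dim_in_second_hyperplane:
  fixes u v :: "'a::euclidean_space"
  assumes "K \<subseteq> {y. u \<bullet> y = 0}" "K \<subseteq> {y. v \<bullet> y = 0}" "u \<noteq> 0" "u \<bullet> x = 0" "v \<bullet> x \<noteq> 0"
  shows "aff_dim K \<noteq> int DIM('a) - 1"
proof
  assume dim: "aff_dim K = int DIM('a) - 1"
  have "affine hull K \<subseteq> {y. u \<bullet> y = 0}" and Q: "affine hull K \<subseteq> {y. v \<bullet> y = 0}"
    using assms(1,2) by (simp_all add: hull_minimal affine_hyperplane)
  moreover have "aff_dim (affine hull K) = aff_dim {y. u \<bullet> y = 0}"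
    using dim \<open>u \<noteq> 0\<close> by (simp add: aff_dim_hyperplane)
  moreover have "affine hull K \<noteq> {}"
    using dim DIM_positive[where 'a='a] by (auto simp: aff_dim_empty_eq)
  ultimately have "affine hull K = {y. u \<bullet> y = 0}"
    by (intro affine_dim_equal) (auto simp: affine_hyperplane)
  then show False
    using Q assms(4,5) by auto
qed

lemma bracket_plucker:
  "bracket A i j * bracket A k l - bracket A i k * bracket A j l + bracket A i l * bracket A j k = 0"
  by (simp add: bracket_def algebra_simps)

text \<open>
  The forms are invariant under translation, so for six lines they span a space of dimension at most
  \<open>6 - 2 = 4\<close>, and five of them are linearly dependent. After a translation that puts the vertex of
  \<open>d\<close> and \<open>e\<close> at the origin, each of the forms \<open>a d e\<close>, \<open>b e f\<close>, \<open>c d f\<close> expresses the constant of one of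
  the lines \<open>a\<close>, \<open>b\<close>, \<open>c\<close> up to a multiple of the constant of \<open>f\<close>, which gives the coefficients.
\<close>
lemma triple_form_relation:
  "bracket A d e * bracket A d f * bracket A e f * triple_form A y a b c =
     bracket A d f * bracket A e f * bracket A b c * triple_form A y a d e
   - bracket A d e * bracket A d f * bracket A a c * triple_form A y b e f
   + bracket A d e * bracket A e f * bracket A a b * triple_form A y c d f
   + (bracket A d f * bracket A b c * bracket A a e + bracket A d e * bracket A a b * bracket A c f)
       * triple_form A y d e f" (is "?L = ?R")
proof -
  let ?P = "\<lambda>i j k l. bracket A i j * bracket A k l - bracket A i k * bracket A j l + bracket A i l * bracket A j k"
  \<comment> \<open>The coefficients of \<open>y $ e\<close> and \<open>y $ f\<close> match modulo Pluecker relations, all others identically.\<close>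
  have "?R = ?L + y $ e * bracket A d f * (bracket A b c * ?P a d e f - bracket A d e * ?P a b c f)
      + y $ f * bracket A d e * (bracket A d f * ?P a b c e + bracket A a b * ?P c d e f)"
    by (simp add: triple_form_def algebra_simps)
  then show ?thesis
    by (simp add: bracket_plucker)
qed

section \<open>Routh configurations\<close>

text \<open>
  Lines \<open>3\<close>, \<open>4\<close>, \<open>5\<close> bound the outer triangle; lines \<open>0\<close>, \<open>1\<close>, \<open>2\<close> are the cevians near the vertices
  \<open>3 \<inter> 4\<close>, \<open>4 \<inter> 5\<close>, \<open>3 \<inter> 5\<close>. The first four inequalities say that every summand on the right of
  \<open>triple_form_relation\<close> is positive at \<open>c\<close>. The last condition puts the three vertices of the inner
  triangle inside the outer one: by \<open>triple_form_vertex\<close> each product is a positive multiple of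
  \<open>c $ l - A $ l \<bullet> p\<close> at the vertex \<open>p\<close>. All conditions are strict, so that they survive a
  perturbation of \<open>A\<close>.
\<close>
definition routh_configuration :: "real^2^6 \<Rightarrow> real^6 \<Rightarrow> bool" where
  "routh_configuration A c \<longleftrightarrow>
     c \<in> disc_complement A \<and>
     0 < bracket A 3 5 * bracket A 4 5 * bracket A 1 2 * triple_form A c 0 3 4 \<and>
     0 < - (bracket A 3 4 * bracket A 3 5 * bracket A 0 2) * triple_form A c 1 4 5 \<and>
     0 < bracket A 3 4 * bracket A 4 5 * bracket A 0 1 * triple_form A c 2 3 5 \<and>
     0 < (bracket A 3 5 * bracket A 1 2 * bracket A 0 4 + bracket A 3 4 * bracket A 0 1 * bracket A 2 5)
       * triple_form A c 3 4 5 \<and>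
     (\<forall>(i, j) \<in> {(0, 1), (0, 2), (1, 2)}.
        bracket A i j * triple_form A c i j 3 < 0 \<and>
        bracket A i j * triple_form A c i j 4 < 0 \<and>
        0 < bracket A i j * triple_form A c i j 5)"

lemma less_6:
  "(0::6) < 1" "(1::6) < 2" "(3::6) < 4" "(4::6) < 5" "(0::6) < 3" "(1::6) < 4" "(2::6) < 3" "(3::6) < 5"
  by (simp_all add: less_bit0_def bit0.Rep_0 bit0.Rep_1 bit0.Rep_numeral)

lemma exhaust_6:
  fixes i :: 6
  shows "i = 0 \<or> i = 1 \<or> i = 2 \<or> i = 3 \<or> i = 4 \<or> i = 5"
proof -
  have "card {0, 1, 2, 3, 4, 5 :: 6} = CARD(6)"
    by simp
  then have "{0, 1, 2, 3, 4, 5 :: 6} = UNIV"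
    by (intro card_subset_eq) auto
  then show ?thesis
    by blast
qed

lemma open_routh_configuration: "open {A. routh_configuration A c}"
proof -
  have cont: "continuous_on UNIV (\<lambda>A::real^2^6. bracket A i j)"
    "continuous_on UNIV (\<lambda>A. triple_form A c i j k)" for i j k
    unfolding triple_form_def bracket_def by (intro continuous_intros)+
  have "{A. c \<in> disc_complement A} = (\<Inter>S\<in>{S. card S = 3}. {A. disc_form S A c \<noteq> 0})"
    by (auto simp: disc_complement_def disc_hyperplane_def)
  moreover have "open {A. disc_form S A c \<noteq> 0}" if S: "card S = 3" for S :: "6 set"
  proof -
    obtain i j k where "S = {i, j, k}" "i < j" "j < k"
      using S by (rule card_3_ordered)
    then show ?thesis
      using cont by (simp add: disc_form_ordered open_Collect_neq)
  qed
  ultimately have "open {A. c \<in> disc_complement A}"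
    by (simp add: open_INT)
  then show ?thesis
    unfolding routh_configuration_def ball_simps split simp_thms
    by (intro open_Collect_conj open_Collect_less cont continuous_intros)
qed

text \<open>
  The outer triangle is bounded by \<open>x = 0\<close>, \<open>y = 0\<close> and \<open>x + y = 30\<close>. Joining each vertex to the point
  that divides the opposite side in the ratio \<open>1 : 2\<close> gives the cevians \<open>x - 2y = 0\<close>,
  \<open>2x + 3y = 60\<close> and \<open>3x + y = 30\<close>; the constants \<open>1\<close>, \<open>61\<close> and \<open>29\<close> move each of them away from
  the centroid \<open>(10, 10)\<close>, past its vertex.
\<close>
lemma routh_configuration_exists: "\<exists>A c. routh_configuration A c"
proof -
  define A :: "real^2^6" where "A = (\<chi> i. vector
    (if i = 0 then [1, -2] else if i = 1 then [2, 3] else if i = 2 then [3, 1]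
     else if i = 3 then [1, 0] else if i = 4 then [0, 1] else [1, 1]))"
  define c :: "real^6" where "c = (\<chi> i. if i = 0 then 1 else if i = 1 then 61 else if i = 2 then 29
     else if i = 5 then 30 else 0)"
  have A: "A $ 0 $ 1 = 1" "A $ 0 $ 2 = -2" "A $ 1 $ 1 = 2" "A $ 1 $ 2 = 3" "A $ 2 $ 1 = 3" "A $ 2 $ 2 = 1"
    "A $ 3 $ 1 = 1" "A $ 3 $ 2 = 0" "A $ 4 $ 1 = 0" "A $ 4 $ 2 = 1" "A $ 5 $ 1 = 1" "A $ 5 $ 2 = 1"
    by (simp_all add: A_def)
  have c: "c $ 0 = 1" "c $ 1 = 61" "c $ 2 = 29" "c $ 3 = 0" "c $ 4 = 0" "c $ 5 = 30"
    by (simp_all add: c_def)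
  have "triple_form A c i j k \<noteq> 0" if "i < j" "j < k" for i j k
    using exhaust_6[of i] exhaust_6[of j] exhaust_6[of k] that
    by (elim disjE; hypsubst)
      (simp_all add: less_bit0_def bit0.Rep_0 bit0.Rep_1 bit0.Rep_numeral
        triple_form_def bracket_def A c)
  then have "c \<in> disc_complement A"
    by (auto simp: disc_complement_def disc_hyperplane_def disc_form_ordered elim!: card_3_ordered)
  then have "routh_configuration A c"
    by (simp add: routh_configuration_def triple_form_def bracket_def A c)
  then show ?thesis
    by blast
qed

lemma routh_triangular_cell:
  assumes R: "routh_configuration A c" and br: "\<And>i j. i \<noteq> j \<Longrightarrow> bracket A i j \<noteq> 0"
    and nz: "\<And>i. A $ i \<noteq> 0"
  shows "\<exists>T. triangular_cell (arr_line A c) 0 1 2 T"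
proof -
  let ?H = "arr_line A c"
  have "bracket A 1 2 \<noteq> 0" "bracket A 0 2 \<noteq> 0" "bracket A 0 1 \<noteq> 0"
    using br by simp_all
  then obtain p q r where v: "?H 1 \<inter> ?H 2 = {p}" "?H 0 \<inter> ?H 2 = {q}" "?H 0 \<inter> ?H 1 = {r}"
    using arr_line_Int_nonparallel by meson
  then have on: "p \<in> ?H 1" "p \<in> ?H 2" "q \<in> ?H 0" "q \<in> ?H 2" "r \<in> ?H 0" "r \<in> ?H 1"
    by auto
  define outer where "outer = {x. A $ 3 \<bullet> x > c $ 3} \<inter> {x. A $ 4 \<bullet> x > c $ 4} \<inter> {x. A $ 5 \<bullet> x < c $ 5}"
  have "x \<in> outer" if x: "x \<in> ?H i" "x \<in> ?H j" and ij: "(i, j) \<in> {(0, 1), (0, 2), (1, 2)}" for x i j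
  proof -
    have "bracket A i j * triple_form A c i j 3 < 0" "bracket A i j * triple_form A c i j 4 < 0"
        "0 < bracket A i j * triple_form A c i j 5"
      using R ij by (auto simp: routh_configuration_def)
    then show ?thesis
      unfolding triple_form_vertex[OF x] outer_def
      by (auto simp: mult_less_0_iff zero_less_mult_iff)
  qed
  then have "{p, q, r} \<subseteq> outer"
    using on by auto
  moreover have "convex outer"
    unfolding outer_def by (intro convex_Int convex_halfspace_gt convex_halfspace_lt)
  ultimately have hull: "convex hull {p, q, r} \<subseteq> outer"
    by (rule hull_minimal)
  have "p \<notin> ?H 0"
  proof
    assume "p \<in> ?H 0"
    then have "triple_form A c 0 1 2 = 0"
      using triple_form_vertex[OF _ on(1), of 0 2] on(2) by (simp add: arr_line_inner)
    then have "c \<in> disc_hyperplane A {0, 1, 2}"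
      using less_6 by (simp add: disc_hyperplane_def disc_form_ordered)
    then show False
      using R by (auto simp: routh_configuration_def disc_complement_def)
  qed
  moreover have "?H l \<inter> convex hull {p, q, r} = {}" if "l \<notin> {0, 1, 2}" for l
  proof -
    have "l = 3 \<or> l = 4 \<or> l = 5"
      using exhaust_6[of l] that by blast
    then have "?H l \<inter> outer = {}"
      by (auto simp: arr_line_inner outer_def)
    then show ?thesis
      using hull by blast
  qed
  ultimately have "triangular_cell ?H 0 1 2 (interior (convex hull {p, q, r}))"
    using v nz by (intro triangular_cellI) auto
  then show ?thesis
    by blast
qed

text \<open>
  On the closure of the region the four summands in \<open>triple_form_relation\<close> keep their nonnegative sign.
  If the form of the inner triangle vanishes there, all four vanish, so the intersection of the
  hyperplane with the closure lies in a second hyperplane.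
\<close>
lemma routh_not_codim_one_boundary:
  assumes R: "routh_configuration A c" and br: "\<And>i j. i \<noteq> j \<Longrightarrow> bracket A i j \<noteq> 0"
    and C: "C \<in> components (disc_complement A)" "c \<in> C"
  shows "\<not> codim_one_boundary (disc_hyperplane A {0, 1, 2}) C"
proof -
  have form: "disc_form {0, 1, 2} A y = triple_form A y 0 1 2"
    "disc_form {0, 3, 4} A y = triple_form A y 0 3 4"
    "disc_form {1, 4, 5} A y = triple_form A y 1 4 5"
    "disc_form {2, 3, 5} A y = triple_form A y 2 3 5"
    "disc_form {3, 4, 5} A y = triple_form A y 3 4 5" for y
    using less_6 by (simp_all add: disc_form_ordered)
  let ?K = "disc_hyperplane A {0, 1, 2} \<inter> closure C"
  have "triple_form A z 0 3 4 = 0" if z: "z \<in> ?K" for z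
  proof -
    have "z \<in> closure C"
      using z by simp
    note sgn = disc_form_sign_on_closure[OF C this]
    have same_sign: "0 \<le> k * v" if "0 < k * u" "0 \<le> u * v" for k u v :: real
      using that by (auto simp: zero_less_mult_iff zero_le_mult_iff)
    let ?k = "bracket A 3 5 * bracket A 4 5 * bracket A 1 2"
    have "0 \<le> ?k * triple_form A z 0 3 4"
      by (rule same_sign[of _ "triple_form A c 0 3 4"])
        (use R sgn[of "{0, 3, 4}"] in \<open>simp_all add: routh_configuration_def form\<close>)
    moreover have "0 \<le> - (bracket A 3 4 * bracket A 3 5 * bracket A 0 2) * triple_form A z 1 4 5"
      by (rule same_sign[of _ "triple_form A c 1 4 5"])
        (use R sgn[of "{1, 4, 5}"] in \<open>simp_all add: routh_configuration_def form\<close>)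
    moreover have "0 \<le> bracket A 3 4 * bracket A 4 5 * bracket A 0 1 * triple_form A z 2 3 5"
      by (rule same_sign[of _ "triple_form A c 2 3 5"])
        (use R sgn[of "{2, 3, 5}"] in \<open>simp_all add: routh_configuration_def form\<close>)
    moreover have "0 \<le> (bracket A 3 5 * bracket A 1 2 * bracket A 0 4
        + bracket A 3 4 * bracket A 0 1 * bracket A 2 5) * triple_form A z 3 4 5"
      by (rule same_sign[of _ "triple_form A c 3 4 5"])
        (use R sgn[of "{3, 4, 5}"] in \<open>simp_all add: routh_configuration_def form\<close>)
    moreover have "triple_form A z 0 1 2 = 0"
      using z by (simp add: disc_hyperplane_def form)
    moreover from calculation have "?k * triple_form A z 0 3 4 \<le> 0"
      using triple_form_relation[of A 3 4 5 z 0 1 2] by simp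
    ultimately have "?k * triple_form A z 0 3 4 = 0"
      by (intro antisym)
    moreover have "?k \<noteq> 0"
      using br by simp
    ultimately show ?thesis
      by simp
  qed
  then have "?K \<subseteq> {y. disc_row A {0, 3, 4} \<bullet> y = 0}"
    by (auto simp: disc_form_eq_inner[symmetric] form)
  moreover have "?K \<subseteq> {y. disc_row A {0, 1, 2} \<bullet> y = 0}"
    by (auto simp: disc_form_eq_inner[symmetric] disc_hyperplane_def)
  moreover have "disc_row A {0, 1, 2} \<noteq> 0"
  proof
    assume "disc_row A {0, 1, 2} = 0"
    then have "disc_row A {0, 1, 2} $ 0 = 0"
      by simp
    then have "bracket A 1 2 = 0"
      by (simp add: disc_row_def form triple_form_def axis_def)
    then show False
      using br[of 1 2] by simp
  qed
  \<comment> \<open>Moving line \<open>3\<close> alone leaves the form of the lines \<open>0\<close>, \<open>1\<close>, \<open>2\<close> unchanged but not that of \<open>0\<close>, \<open>3\<close>, \<open>4\<close>, so the two hyperplanes differ.\<close>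
  moreover have "disc_row A {0, 1, 2} \<bullet> axis 3 1 = 0"
    by (simp add: disc_form_eq_inner[symmetric] form triple_form_def axis_def)
  moreover have "disc_row A {0, 3, 4} \<bullet> axis 3 1 \<noteq> 0"
    using br by (simp add: disc_form_eq_inner[symmetric] form triple_form_def axis_def)
  ultimately have "aff_dim ?K \<noteq> int DIM(real^6) - 1"
    by (intro aff_dim_in_second_hyperplane)
  then show ?thesis
    by (simp add: codim_one_boundary_def)
qed

theorem theoremB:
  shows "\<exists>(A :: real^2^6) (c :: real^6).
     generic_line_arrangement (arr_line A c) \<and>
     very_generic A \<and>
     (\<exists>C. C \<in> components (disc_complement A) \<and> c \<in> C \<and>
        (\<exists>i j k R. triangular_cell (arr_line A c) i j k R \<and>
                   \<not> codim_one_boundary (disc_hyperplane A {i, j, k}) C))"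
proof -
  obtain A0 c where "routh_configuration A0 c"
    using routh_configuration_exists by blast
  then have "\<exists>A\<in>{A. routh_configuration A c}. very_generic A \<and> (\<forall>i j. i \<noteq> j \<longrightarrow> bracket A i j \<noteq> 0)"
    by (intro very_generic_dense open_routh_configuration) auto
  then obtain A where A: "routh_configuration A c" "very_generic A"
    and br: "\<And>i j. i \<noteq> j \<Longrightarrow> bracket A i j \<noteq> 0"
    by blast
  have nz: "A $ i \<noteq> 0" for i
    using independent_pair_bracket(2)[OF br, of i "i + 1"] by (auto simp: dependent_zero)
  have c: "c \<in> disc_complement A"
    using A(1) by (simp add: routh_configuration_def)
  define C where "C = connected_component_set (disc_complement A) c"
  have C: "C \<in> components (disc_complement A)" "c \<in> C"
    using c by (auto simp: C_def components_def connected_component_refl)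
  obtain T where "triangular_cell (arr_line A c) 0 1 2 T"
    using routh_triangular_cell[OF A(1) br nz] by blast
  moreover have "\<not> codim_one_boundary (disc_hyperplane A {0, 1, 2}) C"
    by (rule routh_not_codim_one_boundary[OF A(1) br C])
  moreover have "generic_line_arrangement (arr_line A c)"
    using br nz c by (rule generic_line_arrangement_arr_line)
  ultimately show ?thesis
    using A(2) C by blast
qed

end
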